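(* Let $\omega$ be a factor of the Fibonacci sequence $F_\infty$ with $\omega\notin\{\varepsilon,ab,ba,aba\}$. Then: (1) $\omega$ has exactly two distinct gaps, namely $\nu_{\omega,1}$ and $\nu_{\omega,2}$; i.e. $\nu_{\omega,1}\ne\nu_{\omega,2}$ and $\{\nu_{\omega,p}: p\ge1\}=\{\nu_{\omega,1},\nu_{\omega,2}\}$; (2) the gap sequence $\{\nu_{\omega,p}\}_{p\ge1}$ is the Fibonacci sequence over the alphabet $\{\nu_{\omega,1},\nu_{\omega,2}\}$; that is, for every $p\ge 1$, $\nu_{\omega,p}=\nu_{\omega,1}$ if the $p$-th letter of $F_\infty$ is $a$, and $\nu_{\omega,p}=\nu_{\omega,2}$ if the $p$-th letter of $F_\infty$ is $b$.
   Context: Words are over $\{a,b\}$ and are regarded as elements of the free group on $a,b$; $\varepsilon$ is the empty word. Let $\sigma(a)=ab$, $\sigma(b)=a$, $F_k=\sigma^k(a)$ for $k\ge0$, and $F_\infty=x_1x_2\cdots=\lim_{k\to\infty}F_k=abaababa\cdots$ (Fibonacci sequence). A factor is a finite block of consecutive letters. Every nonempty factor $\omega$ of $F_\infty$ occurs infinitely often; $\omega_p$ denotes its $p$-th occurrence ($p\ge1$, ordered by position). If $\omega_p=x_{i+1}\cdots x_{i+n}$ and $\omega_{p+1}=x_{j+1}\cdots x_{j+n}$ (as positioned blocks), the gap $\nu_{\omega,p}$ is $\varepsilon$ if $i+n=j$; it is the word $x_{i+n+1}\cdots x_j$ if $i+n<j$; and it is the inverse $(x_{j+1}\cdots x_{i+n})^{-1}$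 of the overlap if $i+n>j$. The sequence $\{\nu_{\omega,p}\}_{p\ge1}$ is the gap sequence of $\omega$. *)

theory Defs
  imports Main "HOL-Library.Sublist" "HOL-Library.Infinite_Set"
begin

section \<open>Free groups\<close>

text \<open>
  A signed letter is a pair of a letter and a Boolean, where \<open>(x, True)\<close> stands for \<open>x\<close> and
  \<open>(x, False)\<close> for its formal inverse. The free group is the quotient of the signed words by
  the equivalence relation generated by deleting adjacent mutually inverse letters.
\<close>

inductive cancel :: "('x \<times> bool) list \<Rightarrow> ('x \<times> bool) list \<Rightarrow> bool" where
  cancelI: "cancel (u @ (x, s) # (x, \<not> s) # v) (u @ v)"

lemma cancel_append: "cancel u v \<Longrightarrow> cancel (p @ u @ q) (p @ v @ q)"
proof (induction rule: cancel.induct)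
  case (cancelI u x s v)
  then show ?case using cancel.cancelI[of "p @ u" x s "v @ q"] by simp
qed

lemma equivclp_map:
  assumes "equivclp r x y" and "\<And>x y. r x y \<Longrightarrow> r (f x) (f y)"
  shows "equivclp r (f x) (f y)"
  using assms(1)
proof (induction rule: equivclp_induct)
  case base
  then show ?case by simp
next
  case (step y z)
  then show ?case
    using assms(2) by (blast intro: equivclp_into_equivclp)
qed

lemma equivclp_cancel_append:
  assumes "equivclp cancel u u'" "equivclp cancel v v'"
  shows "equivclp cancel (u @ v) (u' @ v')"
proof -
  have "equivclp cancel (u @ v) (u' @ v)"
    using equivclp_map[OF assms(1), of "\<lambda>w. w @ v"] cancel_append[of _ _ "[]" v] by simp
  moreover have "equivclp cancel (u' @ v) (u' @ v')"
    using equivclp_map[OF assms(2), of "\<lambda>w. u' @ w"] cancel_append[of _ _ u' "[]"] by simp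
  ultimately show ?thesis by (rule equivclp_trans)
qed

definition inv_word :: "('x \<times> bool) list \<Rightarrow> ('x \<times> bool) list" where
  "inv_word w = rev (map (\<lambda>(x, s). (x, \<not> s)) w)"

lemma cancel_inv_word: "cancel u v \<Longrightarrow> cancel (inv_word u) (inv_word v)"
proof (induction rule: cancel.induct)
  case (cancelI u x s v)
  then show ?case
    using cancel.cancelI[of "inv_word v" x s "inv_word u"] by (simp add: inv_word_def)
qed

lemma equivclp_cancel_inv_word: "equivclp cancel (inv_word w @ w) []"
proof (induction w)
  case Nil
  then show ?case by (simp add: inv_word_def)
next
  case (Cons y w)
  obtain x s where y: "y = (x, s)" by force
  have "cancel (inv_word (y # w) @ y # w) (inv_word w @ w)"
    using cancel.cancelI[of "inv_word w" x "\<not> s" w] by (simp add: inv_word_def y)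
  then show ?case using Cons by (blast intro: equivclp_trans r_into_equivclp)
qed

quotient_type 'x free_group = "('x \<times> bool) list" / "equivclp cancel"
  by (simp add: equivp_evquivclp)

instantiation free_group :: (type) "{monoid_mult, inverse}"
begin

lift_definition one_free_group :: "'x free_group" is "[]" .

lift_definition times_free_group :: "'x free_group \<Rightarrow> 'x free_group \<Rightarrow> 'x free_group" is "(@)"
  by (rule equivclp_cancel_append)

lift_definition inverse_free_group :: "'x free_group \<Rightarrow> 'x free_group" is inv_word
  by (rule equivclp_map) (auto intro: cancel_inv_word)

definition divide_free_group :: "'x free_group \<Rightarrow> 'x free_group \<Rightarrow> 'x free_group" where
  "divide_free_group g h = g * inverse h"

instance
  by standard (transfer; simp)+

end

lemma free_group_left_inverse: "inverse g * g = (1 :: 'x free_group)"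
  by transfer (rule equivclp_cancel_inv_word)

lift_definition of_word :: "'x list \<Rightarrow> 'x free_group" is "map (\<lambda>x. (x, True))" .

section \<open>The Fibonacci sequence\<close>

datatype letter = A | B

fun \<sigma>_letter :: "letter \<Rightarrow> letter list" where
  "\<sigma>_letter A = [A, B]"
| "\<sigma>_letter B = [A]"

definition \<sigma> :: "letter list \<Rightarrow> letter list" where
  "\<sigma> w = concat (map \<sigma>_letter w)"

definition F :: "nat \<Rightarrow> letter list" where
  "F k = (\<sigma> ^^ k) [A]"

lemma prefix_F_Suc: "prefix (F k) (F (Suc k))"
proof (induction k)
  case 0
  then show ?case by (simp add: F_def \<sigma>_def)
next
  case (Suc k)
  then obtain v where "F (Suc k) = F k @ v" by (auto simp: prefix_def)
  then have "\<sigma> (F (Suc k)) = \<sigma> (F k) @ \<sigma> v" by (simp add: \<sigma>_def)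
  then show ?case by (simp add: F_def)
qed

lemma prefix_F: "j \<le> k \<Longrightarrow> prefix (F j) (F k)"
proof (induction rule: dec_induct)
  case (step k)
  then show ?case using prefix_F_Suc[of k] by (rule_tac prefix_order.trans)
qed simp

lemma length_\<sigma>: "length w \<le> length (\<sigma> w)"
proof (induction w)
  case (Cons x w)
  then show ?case by (cases x) (simp_all add: \<sigma>_def)
qed (simp add: \<sigma>_def)

lemma length_F: "k < length (F k)"
proof (induction k)
  case (Suc k)
  obtain v where v: "F k = A # v"
    using prefix_F[of 0 k] by (auto simp: prefix_def F_def)
  have "length (F (Suc k)) = length (\<sigma> (F k))" by (simp add: F_def)
  also have "\<dots> = 2 + length (\<sigma> v)" by (simp add: v \<sigma>_def)
  finally show ?case using Suc length_\<sigma>[of v] by (simp add: v)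
qed (simp add: F_def)

text \<open>
  The limit of the words \<open>F k\<close>, indexed from 0: \<open>fib_seq i\<close> is the letter \<open>x\<^bsub>i+1\<^esub>\<close>.
\<close>

definition fib_seq :: "nat \<Rightarrow> letter" where
  "fib_seq i = (THE x. \<forall>k. i < length (F k) \<longrightarrow> F k ! i = x)"

lemma F_nth_eq_fib_seq:
  assumes "i < length (F k)"
  shows "F k ! i = fib_seq i"
proof -
  have eq: "F j ! i = F k ! i" if "i < length (F j)" for j
  proof (cases "j \<le> k")
    case True
    then obtain v where "F k = F j @ v" using prefix_F unfolding prefix_def by blast
    with that show ?thesis by (simp add: nth_append)
  next
    case False
    then obtain v where "F j = F k @ v"
      using prefix_F[of k j] unfolding prefix_def by auto
    with assms show ?thesis by (simp add: nth_append)
  qed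
  have "(THE x. \<forall>k. i < length (F k) \<longrightarrow> F k ! i = x) = F k ! i"
    using eq assms by (intro the_equality) blast+
  then show ?thesis by (simp add: fib_seq_def)
qed

section \<open>Occurrences and gaps\<close>

text \<open>\<open>block i n\<close> is the word \<open>x\<^bsub>i+1\<^esub> \<dots> x\<^bsub>i+n\<^esub>\<close>.\<close>

definition block :: "nat \<Rightarrow> nat \<Rightarrow> letter list" where
  "block i n = map fib_seq [i..<i + n]"

definition is_factor :: "letter list \<Rightarrow> bool" where
  "is_factor w \<longleftrightarrow> (\<exists>i n. w = block i n)"

definition occurrences :: "letter list \<Rightarrow> nat set" where
  "occurrences w = {i. block i (length w) = w}"

text \<open>
  \<open>occ w p\<close> is the offset \<open>i\<close> such that \<open>x\<^bsub>i+1\<^esub> \<dots> x\<^bsub>i+n\<^esub>\<close> is the \<open>p\<close>-th occurrence of \<open>w\<close>, for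
  \<open>p \<ge> 1\<close> and a nonempty factor \<open>w\<close> (whose set of occurrences is infinite).
\<close>

definition occ :: "letter list \<Rightarrow> nat \<Rightarrow> nat" where
  "occ w p = enumerate (occurrences w) (p - 1)"

definition gap :: "letter list \<Rightarrow> nat \<Rightarrow> letter free_group" where
  "gap w p =
    (let n = length w; i = occ w p; j = occ w (p + 1) in
     if i + n = j then 1
     else if i + n < j then of_word (block (i + n) (j - (i + n)))
     else inverse (of_word (block j (i + n - j))))"

end

theory Submission
  imports Defs
begin

text \<open>
  A return word of a factor \<open>w\<close> is the block from the start of one occurrence of \<open>w\<close> to the start
  of the next. Knowing \<open>w\<close>, the return word determines the gap: it is what remains of the return
  word after removing its prefix \<open>w\<close>, or the inverse of the overlap if the return word is shorter
  than \<open>w\<close>. So it suffices that the \<open>p\<close>-th return word of \<open>w\<close> depends only on the \<open>p\<close>-th letter of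
  the Fibonacci sequence, say it is \<open>R A\<close> or \<open>R B\<close>, and that \<open>R A\<close> and \<open>R B\<close> differ in length: the
  exponent sum of a gap in the free group is the length of the return word minus the length of
  \<open>w\<close>, so it tells the two gaps apart.

  The code \<open>R\<close> comes from desubstitution. The Fibonacci sequence is fixed by \<open>\<sigma>\<close>, hence cut into
  the blocks \<open>\<sigma> A\<close> and \<open>\<sigma> B\<close>, and an \<open>A\<close> stands exactly at the start of each block. Every \<open>B\<close> has
  an \<open>A\<close> on both sides, so \<open>w\<close> may be enlarged to a word that starts and ends with \<open>A\<close> without
  changing its occurrences, except for a shift by one. Such a word is \<open>\<sigma> u @ [A]\<close> for a factor
  \<open>u\<close>, and its occurrences are the images of those of \<open>u\<close> (\<open>occurrences_\<sigma>\<close>). Therefore its return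
  words are the images under \<open>\<sigma>\<close> of those of \<open>u\<close>, in the same order (\<open>return_words_\<sigma>\<close>). As \<open>u\<close>
  is simpler than \<open>w\<close>, induction leads down to the word \<open>A\<close>, whose return words are
  \<open>\<sigma> A\<close> and \<open>\<sigma> B\<close> themselves (\<open>return_words_exist\<close>).
\<close>

section \<open>Blocks\<close>

lemma length_block [simp]: "length (block i n) = n"
  by (simp add: block_def)

lemma block_0 [simp]: "block i 0 = []"
  by (simp add: block_def)

lemma block_Suc: "block i (Suc n) = fib_seq i # block (Suc i) n"
  by (simp add: block_def upt_conv_Cons del: upt_Suc)

lemma block_Suc_right: "block i (Suc n) = block i n @ [fib_seq (i + n)]"
  by (simp add: block_def)

lemma block_add: "block i (m + n) = block i m @ block (i + m) n"
  by (induction n) (simp_all add: block_Suc_right add.assoc)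

lemma take_block: "m \<le> n \<Longrightarrow> take m (block i n) = block i m"
  using block_add[of i m "n - m"] by simp

lemma drop_block: "m \<le> n \<Longrightarrow> drop m (block i n) = block (i + m) (n - m)"
  using block_add[of i m "n - m"] by simp

lemma occurrences_iff_block: "i \<in> occurrences w \<longleftrightarrow> block i (length w) = w"
  by (simp add: occurrences_def)

section \<open>The Fibonacci sequence as a fixed point\<close>

lemma \<sigma>_simps [simp]:
  "\<sigma> [] = []" "\<sigma> (x # u) = \<sigma>_letter x @ \<sigma> u" "\<sigma> (u @ v) = \<sigma> u @ \<sigma> v"
  by (simp_all add: \<sigma>_def)

lemma hd_\<sigma>_A [simp]: "hd (\<sigma> u @ [A]) = A"
  by (cases u; cases "hd u") simp_all

lemma F_eq_block: "F k = block 0 (length (F k))"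
  by (rule nth_equalityI) (simp_all add: block_def F_nth_eq_fib_seq)

text \<open>The offset at which the image under \<open>\<sigma>\<close> of the letter with index \<open>i\<close> starts.\<close>

definition cut :: "nat \<Rightarrow> nat" where
  "cut i = length (\<sigma> (block 0 i))"

text \<open>
  The fixed point property: \<open>\<sigma>\<close> maps \<open>F i\<close> to \<open>F (Suc i)\<close>, and both are prefixes of the sequence.
\<close>

lemma block_0_cut: "block 0 (cut i) = \<sigma> (block 0 i)"
proof -
  have "F i = block 0 i @ block i (length (F i) - i)"
    using F_eq_block[of i] block_add[of 0 i "length (F i) - i"] length_F[of i] by simp
  then have "\<sigma> (F i) = \<sigma> (block 0 i) @ \<sigma> (block i (length (F i) - i))"
    by (metis \<sigma>_simps(3))
  then have pre: "F (Suc i) = \<sigma> (block 0 i) @ \<sigma> (block i (length (F i) - i))"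
    by (simp add: F_def)
  then have "cut i \<le> length (F (Suc i))" by (simp add: cut_def)
  then have "block 0 (cut i) = take (cut i) (F (Suc i))"
    by (subst F_eq_block) (simp add: take_block)
  then show ?thesis by (simp add: pre cut_def)
qed

lemma cut_0 [simp]: "cut 0 = 0"
  by (simp add: cut_def)

lemma cut_Suc: "cut (Suc i) = cut i + length (\<sigma>_letter (fib_seq i))"
  by (simp add: cut_def block_Suc_right)

lemma strict_mono_cut: "strict_mono cut"
  unfolding strict_mono_Suc_iff
proof
  fix i show "cut i < cut (Suc i)"
    by (cases "fib_seq i") (simp_all add: cut_Suc)
qed

lemma block_cut:
  assumes "i \<le> j"
  shows "block (cut i) (cut j - cut i) = \<sigma> (block i (j - i))"
proof -
  have "cut i \<le> cut j"
    using assms strict_mono_cut by (simp add: strict_mono_less_eq)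
  then have "block 0 (cut j) = block 0 (cut i) @ block (cut i) (cut j - cut i)"
    using block_add[of 0 "cut i" "cut j - cut i"] by simp
  moreover have "\<sigma> (block 0 j) = \<sigma> (block 0 i) @ \<sigma> (block i (j - i))"
    using block_add[of 0 i "j - i"] assms by simp
  ultimately show ?thesis by (simp add: block_0_cut)
qed

lemma block_cut_letter:
  "block (cut i) (length (\<sigma>_letter (fib_seq i))) = \<sigma>_letter (fib_seq i)"
  using block_cut[of i "Suc i"] by (simp add: cut_Suc block_Suc)

lemma fib_seq_cut: "fib_seq (cut i) = A"
  using block_cut_letter[of i] by (cases "fib_seq i") (simp_all add: block_Suc)

lemma fib_seq_Suc_cut: "fib_seq (Suc (cut i)) = B \<longleftrightarrow> fib_seq i = A"
  using block_cut_letter[of i] fib_seq_cut[of "Suc i"]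
  by (cases "fib_seq i") (simp_all add: block_Suc cut_Suc)

lemma position_cases:
  obtains (cut) i where "j = cut i" | (inner) i where "j = Suc (cut i)" "fib_seq i = A"
proof -
  have "\<exists>i. j = cut i \<or> (j = Suc (cut i) \<and> fib_seq i = A)"
  proof (induction j)
    case 0
    then show ?case by (intro exI[of _ 0]) simp
  next
    case (Suc j)
    then obtain i where i: "j = cut i \<or> (j = Suc (cut i) \<and> fib_seq i = A)" ..
    show ?case
      using i by (cases "fib_seq i") (force simp: cut_Suc intro: exI[of _ "Suc i"])+
  qed
  then show thesis using that by blast
qed

text \<open>
  The letter \<open>A\<close> marks the block boundaries, because it starts \<open>\<sigma> A\<close> and \<open>\<sigma> B\<close> and occurs nowhere
  else in them. This is what makes the decomposition into blocks readable from the sequence.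
\<close>

lemma fib_seq_eq_A_iff: "fib_seq j = A \<longleftrightarrow> j \<in> range cut"
proof (cases j rule: position_cases)
  case (inner i)
  then have "fib_seq j = B" by (simp add: fib_seq_Suc_cut)
  then show ?thesis using fib_seq_cut by fastforce
qed (simp add: fib_seq_cut)

lemma B_has_A_neighbours:
  assumes "fib_seq j = B"
  obtains i where "j = Suc i" "fib_seq i = A" "fib_seq (Suc j) = A"
proof (cases j rule: position_cases)
  case (cut i)
  then show thesis using assms fib_seq_cut by simp
next
  case (inner i)
  then have "fib_seq (Suc j) = A"
    using fib_seq_cut[of "Suc i"] by (simp add: cut_Suc)
  then show thesis using inner that fib_seq_cut by blast
qed

section \<open>Occurrences under desubstitution\<close>

lemma occurrences_A_left:
  "occurrences (B # v) = Suc ` occurrences (A # B # v)" (is "occurrences ?w = _")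
proof (intro equalityI subsetI)
  fix j assume j: "j \<in> occurrences ?w"
  then have "fib_seq j = B" by (simp add: occurrences_iff_block block_Suc)
  then obtain i where "j = Suc i" "fib_seq i = A" by (rule B_has_A_neighbours)
  with j show "j \<in> Suc ` occurrences (A # ?w)"
    by (auto simp: occurrences_iff_block block_Suc)
qed (auto simp: occurrences_iff_block block_Suc)

lemma occurrences_A_right:
  "occurrences (v @ [B]) = occurrences (v @ [B] @ [A])" (is "occurrences ?w = _")
proof (intro equalityI subsetI)
  fix j assume j: "j \<in> occurrences ?w"
  then have "fib_seq (j + length v) = B"
    by (simp add: occurrences_iff_block block_Suc_right)
  then have "fib_seq (Suc (j + length v)) = A"
    by (auto elim: B_has_A_neighbours)
  with j show "j \<in> occurrences (v @ [B] @ [A])"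
    by (simp add: occurrences_iff_block block_Suc_right)
qed (simp add: occurrences_iff_block block_Suc_right)

text \<open>
  Decoding is deterministic: the letter after a block's initial \<open>A\<close> is \<open>B\<close> in \<open>\<sigma> A\<close>, and after \<open>\<sigma> B\<close>
  it is the initial \<open>A\<close> of the next block. The final \<open>A\<close> provides this information for the last
  letter of \<open>u\<close>.
\<close>

lemma occurrence_\<sigma>_cut_iff:
  "cut i \<in> occurrences (\<sigma> u @ [A]) \<longleftrightarrow> i \<in> occurrences u"
proof (induction u arbitrary: i)
  case Nil
  then show ?case by (simp add: occurrences_iff_block block_Suc fib_seq_cut)
next
  case (Cons x u)
  show ?case
  proof (cases "x = fib_seq i")
    case True
    have "cut i \<in> occurrences (\<sigma> (x # u) @ [A]) \<longleftrightarrow> cut (Suc i) \<in> occurrences (\<sigma> u @ [A])"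
      using block_add[of "cut i" "length (\<sigma>_letter x)" "length (\<sigma> u @ [A])"]
        block_cut_letter[of i]
      by (simp add: occurrences_iff_block True cut_Suc)
    also have "\<dots> \<longleftrightarrow> i \<in> occurrences (x # u)"
      using Cons.IH[of "Suc i"] by (simp add: occurrences_iff_block block_Suc True)
    finally show ?thesis .
  next
    case False
    moreover from this have "cut i \<notin> occurrences (\<sigma> (x # u) @ [A])"
      using fib_seq_Suc_cut[of i] hd_\<sigma>_A[of u]
      by (cases x; cases "fib_seq i"; cases "\<sigma> u @ [A]")
        (auto simp: occurrences_iff_block block_Suc)
    ultimately show ?thesis by (simp add: occurrences_iff_block block_Suc)
  qed
qed

text \<open>
  Since the word starts with \<open>A\<close>, it can occur only at a block boundary.
\<close>

lemma occurrences_\<sigma>: "occurrences (\<sigma> u @ [A]) = cut ` occurrences u"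
proof -
  have "j \<in> range cut" if "j \<in> occurrences (\<sigma> u @ [A])" for j
  proof -
    have "fib_seq j = A"
      using that hd_\<sigma>_A[of u] by (cases "\<sigma> u @ [A]") (auto simp: occurrences_iff_block block_Suc)
    then show ?thesis by (simp add: fib_seq_eq_A_iff)
  qed
  then show ?thesis
    using occurrence_\<sigma>_cut_iff by blast
qed

text \<open>
  An occurrence that starts and ends with \<open>A\<close> runs from one block boundary to the first letter
  after another, so that the blocks between them spell out \<open>\<sigma> u\<close>.
\<close>

lemma desubstitute:
  assumes "occurrences w \<noteq> {}" "hd w = A" "last w = A" "w \<noteq> []"
  obtains u where "w = \<sigma> u @ [A]"
proof -
  obtain n where n: "length w = Suc n" using assms(4) by (cases w) auto
  obtain j where "j \<in> occurrences w" using assms(1) by blast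
  then have j: "block j (Suc n) = w" by (simp add: occurrences_iff_block n)
  have "fib_seq j = A"
    using assms(2) j by (auto simp: block_Suc)
  then obtain i where i: "j = cut i" by (auto simp: fib_seq_eq_A_iff)
  have w: "w = block j n @ [A]" and "fib_seq (j + n) = A"
    using assms(3) j by (auto simp: block_Suc_right)
  then obtain k where k: "j + n = cut k" by (auto simp: fib_seq_eq_A_iff)
  then have "i \<le> k"
    using i strict_mono_cut by (metis le_add1 strict_mono_less_eq)
  then have "block j n = \<sigma> (block i (k - i))"
    using block_cut[of i k] i k by (metis add_diff_cancel_left')
  then show thesis using that w by metis
qed

section \<open>Return words\<close>

text \<open>
  The function \<open>g\<close> lists the occurrences of \<open>w\<close> in order, so its existence also says that there are
  infinitely many; \<open>R\<close> codes the return words by the letters of the Fibonacci sequence.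
\<close>

definition return_words :: "letter list \<Rightarrow> (letter \<Rightarrow> letter list) \<Rightarrow> bool" where
  "return_words w R \<longleftrightarrow> (\<exists>g. strict_mono g \<and> range g = occurrences w \<and>
     (\<forall>p. block (g p) (g (Suc p) - g p) = R (fib_seq p)))"

text \<open>
  A strict order on letter counts. A strict inequality of lengths alone is not preserved by \<open>\<sigma>\<close>,
  as \<open>\<sigma> [A, A]\<close> and \<open>\<sigma> [B, B, B]\<close> show, but together with an inequality for each letter it is.
\<close>

definition dominates :: "letter list \<Rightarrow> letter list \<Rightarrow> bool" where
  "dominates u v \<longleftrightarrow> (\<forall>x. count_list v x \<le> count_list u x) \<and> length v < length u"

lemma length_eq_counts: "length u = count_list u A + count_list u B"
proof (induction u)
  case (Cons x u)
  then show ?case by (cases x) simp_all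
qed simp

lemma count_list_\<sigma>:
  "count_list (\<sigma> u) A = count_list u A + count_list u B"
  "count_list (\<sigma> u) B = count_list u A"
proof (induction u)
  case (Cons x u)
  {
    case 1 then show ?case using Cons by (cases x) simp_all
  next
    case 2 then show ?case using Cons by (cases x) simp_all
  }
qed simp_all

lemma dominates_\<sigma>:
  assumes "dominates u v"
  shows "dominates (\<sigma> u) (\<sigma> v)"
proof -
  have le: "count_list v A \<le> count_list u A" "count_list v B \<le> count_list u B"
    and less: "count_list v A + count_list v B < count_list u A + count_list u B"
    using assms by (auto simp: dominates_def length_eq_counts)
  have "count_list (\<sigma> v) x \<le> count_list (\<sigma> u) x" for x
    using le by (cases x) (simp_all add: count_list_\<sigma>)
  moreover have "length (\<sigma> v) < length (\<sigma> u)"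
    using le less by (simp add: length_eq_counts count_list_\<sigma>)
  ultimately show ?thesis by (simp add: dominates_def)
qed

lemma return_words_cong:
  "occurrences v = occurrences w \<Longrightarrow> return_words v R \<longleftrightarrow> return_words w R"
  by (simp add: return_words_def)

lemma return_words_\<sigma>:
  assumes "return_words u R"
  shows "return_words (\<sigma> u @ [A]) (\<lambda>x. \<sigma> (R x))"
proof -
  obtain g where g: "strict_mono g" "range g = occurrences u"
    "\<And>p. block (g p) (g (Suc p) - g p) = R (fib_seq p)"
    using assms by (auto simp: return_words_def)
  have "strict_mono (cut \<circ> g)"
    using strict_mono_cut g(1) by (simp add: strict_mono_def)
  moreover have "range (cut \<circ> g) = occurrences (\<sigma> u @ [A])"
    using g(2) by (simp add: occurrences_\<sigma> flip: image_image)
  moreover have "block (cut (g p)) (cut (g (Suc p)) - cut (g p)) = \<sigma> (R (fib_seq p))" for p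
    using g(1,3) by (simp add: block_cut strict_mono_less_eq)
  ultimately show ?thesis unfolding return_words_def by (intro exI[of _ "cut \<circ> g"]) simp
qed

text \<open>
  All occurrences of \<open>w\<close> lie one place to the right of those of \<open>A # w\<close>. So each return word loses
  its first letter \<open>A\<close> and gains the first letter of the next occurrence, which is \<open>A\<close> again.
\<close>

lemma return_words_rotate:
  assumes "return_words (A # w) R" "w = B # v"
  shows "return_words w (\<lambda>x. rotate1 (R x))"
proof -
  obtain g where g: "strict_mono g" "range g = occurrences (A # w)"
    "\<And>p. block (g p) (g (Suc p) - g p) = R (fib_seq p)"
    using assms by (auto simp: return_words_def)
  have A: "fib_seq (g p) = A" for p
  proof -
    have "g p \<in> occurrences (A # w)" using g(2) by blast
    then show ?thesis by (simp add: occurrences_iff_block block_Suc)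
  qed
  have rot: "block (Suc (g p)) (g (Suc p) - g p) = rotate1 (R (fib_seq p))" for p
  proof -
    have "g p < g (Suc p)" using g(1) by (simp add: strict_mono_Suc_iff)
    then obtain n where n: "g (Suc p) - g p = Suc n" "g (Suc p) = Suc (g p) + n"
      by (metis add_Suc_right add_Suc_shift diff_add_inverse less_iff_Suc_add)
    have "R (fib_seq p) = A # block (Suc (g p)) n"
      using g(3)[of p] A by (simp add: n block_Suc)
    moreover have "block (Suc (g p)) (Suc n) = block (Suc (g p)) n @ [A]"
      using A[of "Suc p"] by (simp add: block_Suc_right n(2))
    ultimately show ?thesis by (simp add: n(1))
  qed
  have "strict_mono (Suc \<circ> g)" using g(1) by (simp add: strict_mono_Suc_iff)
  moreover have "range (Suc \<circ> g) = occurrences w"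
    using g(2) occurrences_A_left[of v] assms(2) by (simp flip: image_image)
  ultimately show ?thesis
    unfolding return_words_def using rot by (intro exI[of _ "Suc \<circ> g"]) simp
qed

text \<open>
  The empty word occurs everywhere, and its return words are the letters of the sequence.
\<close>

lemma return_words_A: "return_words [A] \<sigma>_letter"
proof -
  have "return_words [] (\<lambda>x. [x])"
    unfolding return_words_def
    by (intro exI[of _ "\<lambda>p. p"]) (auto simp: strict_mono_def occurrences_def block_Suc)
  from return_words_\<sigma>[OF this] show ?thesis by simp
qed

text \<open>
  The induction behind the theorem. Here \<open>l\<close> is \<open>w\<close> with an \<open>A\<close> added on the left if it starts
  with \<open>B\<close>, and \<open>c\<close> is \<open>l\<close> with an \<open>A\<close> added on the right if it ends with \<open>B\<close>. If \<open>w\<close> starts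
  with \<open>B\<close>, then \<open>u\<close> can be as long as \<open>w\<close> (this happens for \<open>w = [B]\<close>, where \<open>u = [A]\<close>), but in
  this case \<open>u\<close> starts with \<open>A\<close>; the second summand of the measure accounts for that. The
  induction stops at \<open>c = [A]\<close> and not at the empty word, whose return words \<open>A\<close> and \<open>B\<close> are of
  equal length.
\<close>

lemma return_words_exist:
  assumes "occurrences w \<noteq> {}" "w \<noteq> []"
  shows "\<exists>R. return_words w R \<and> dominates (R A) (R B)"
  using assms
proof (induction "2 * length w + (if hd w = B then 1 else 0)" arbitrary: w rule: less_induct)
  case less
  define l where "l = (if hd w = B then A # w else w)"
  define c where "c = (if last w = B then l @ [A] else l)"
  have left: "occurrences w = (if hd w = B then Suc ` occurrences l else occurrences l)"
    using less.prems(2) by (cases w) (auto simp: l_def occurrences_A_left)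
  have l: "hd l = A" "last l = last w" "l \<noteq> []"
    using less.prems(2) letter.exhaust[of "hd w"] by (auto simp: l_def)
  have right: "occurrences l = occurrences c"
  proof (cases "last w = B")
    case True
    then have "butlast l @ [B] = l" using l by (metis append_butlast_last_id)
    then show ?thesis
      using occurrences_A_right[of "butlast l"] True by (metis append_assoc c_def)
  qed (simp add: c_def)
  have "occurrences c \<noteq> {}" using less.prems(1) left right by (auto split: if_splits)
  moreover have "hd c = A" "last c = A" "c \<noteq> []"
    using l letter.exhaust[of "last w"] by (auto simp: c_def)
  ultimately obtain u where u: "c = \<sigma> u @ [A]" by (rule desubstitute)
  have "\<exists>R. return_words c R \<and> dominates (R A) (R B)"
  proof (cases "u = []")
    case True
    then have "c = [A]" using u by simp
    moreover have "dominates (\<sigma>_letter A) (\<sigma>_letter B)" by (auto simp: dominates_def)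
    ultimately show ?thesis using return_words_A by blast
  next
    case False
    have u_occ: "occurrences u \<noteq> {}"
      using \<open>occurrences c \<noteq> {}\<close> by (simp add: u occurrences_\<sigma>)
    have sum: "length (\<sigma> u) = length u + count_list u A"
      by (simp add: length_eq_counts count_list_\<sigma>)
    have len: "Suc (length (\<sigma> u))
        = length w + (if hd w = B then 1 else 0) + (if last w = B then 1 else 0)"
      using arg_cong[OF u, of length] by (simp add: c_def l_def split: if_splits)
    \<comment> \<open>A letter is added only next to a \<open>B\<close>, and each \<open>B\<close> in \<open>\<sigma> u\<close> comes from an \<open>A\<close> in \<open>u\<close>. Its
      image has length 2, which compensates for an added letter.\<close>
    have A_in_u: "A \<in> set u" if "hd w = B \<or> last w = B"
    proof -
      have "B \<in> set w" using that less.prems(2) by (metis hd_in_set last_in_set)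
      then have "B \<in> set c" by (auto simp: c_def l_def)
      then show ?thesis
        using count_list_0_iff[of "\<sigma> u" B] count_list_0_iff[of u A]
        by (auto simp: u count_list_\<sigma>)
    qed
    have "2 * length u + (if hd u = B then 1 else 0)
        < 2 * length w + (if hd w = B then 1 else 0)"
    proof (cases "hd w = B")
      case True
      then have "A \<in> set u" using A_in_u by simp
      \<comment> \<open>The word \<open>c\<close> starts with \<open>A\<close>, \<open>B\<close>, whereas \<open>\<sigma> B\<close> is followed by another \<open>A\<close>.\<close>
      moreover have "hd u = A"
      proof (rule ccontr)
        assume "hd u \<noteq> A"
        then obtain v where "u = B # v" using False by (cases u; cases "hd u") auto
        then have "\<sigma> u @ [A] = A # \<sigma> v @ [A]" by simp
        moreover have "hd (\<sigma> v @ [A]) = A" by simp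
        moreover have "hd (tl c) = B"
          using True less.prems(2) by (cases w) (auto simp: c_def l_def)
        ultimately show False using u by simp
      qed
      ultimately show ?thesis using True sum len count_list_0_iff[of u A]
        by (auto split: if_splits)
    next
      case hd: False
      then show ?thesis using sum len A_in_u count_list_0_iff[of u A]
        by (auto split: if_splits)
    qed
    then obtain R where "return_words u R" "dominates (R A) (R B)"
      using less.hyps u_occ False by blast
    then show ?thesis using return_words_\<sigma> dominates_\<sigma> u by blast
  qed
  then obtain R where R: "return_words l R" "dominates (R A) (R B)"
    using return_words_cong[OF right] by blast
  show ?case
  proof (cases "hd w = B")
    case True
    then obtain v where "w = B # v" using less.prems(2) by (cases w) auto
    then have "return_words w (\<lambda>x. rotate1 (R x))"
      using R(1) return_words_rotate by (simp add: l_def)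
    moreover have "count_list (rotate1 v) x = count_list v x" for v :: "letter list" and x
      by (cases v) auto
    then have "dominates (rotate1 (R A)) (rotate1 (R B))"
      using R(2) by (simp add: dominates_def)
    ultimately show ?thesis by blast
  next
    case False
    then show ?thesis using R by (auto simp: l_def)
  qed
qed

section \<open>Gaps\<close>

lift_definition exponent_sum :: "'x free_group \<Rightarrow> int" is
  "\<lambda>u. \<Sum>(x, s)\<leftarrow>u. if s then 1 else - 1"
proof -
  fix u v :: "('x \<times> bool) list"
  assume "equivclp cancel u v"
  then show "(\<Sum>(x, s)\<leftarrow>u. if s then 1 else - 1) = (\<Sum>(x, s)\<leftarrow>v. if s then 1 else - 1 :: int)"
  proof (induction rule: equivclp_induct)
    case (step y z)
    have "(\<Sum>(x, s)\<leftarrow>u. if s then 1 else - 1) = (\<Sum>(x, s)\<leftarrow>v. if s then 1 else - 1 :: int)"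
      if "cancel u v" for u v :: "('x \<times> bool) list"
      using that by (cases rule: cancel.cases) auto
    then show ?case using step by metis
  qed simp
qed

lemma exponent_sum_of_word: "exponent_sum (of_word u) = int (length u)"
proof (transfer)
  fix u :: "'x list"
  show "(\<Sum>(x, s)\<leftarrow>map (\<lambda>x. (x, True)) u. if s then 1 else - 1) = int (length u)"
    by (induction u) auto
qed

lemma exponent_sum_inverse: "exponent_sum (inverse g) = - exponent_sum g"
proof (transfer)
  fix u :: "('x \<times> bool) list"
  show "(\<Sum>(x, s)\<leftarrow>inv_word u. if s then 1 else - 1) =
      - (\<Sum>(x, s)\<leftarrow>u. if s then 1 else - 1 :: int)"
    by (induction u) (auto simp: inv_word_def)
qed

text \<open>
  The gap after an occurrence of \<open>w\<close> with return word \<open>r\<close>. In the second case the overlap of the two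
  occurrences is a prefix of the later one, which is why it can be read off from \<open>w\<close>.
\<close>

definition gap_of :: "letter list \<Rightarrow> letter list \<Rightarrow> letter free_group" where
  "gap_of w r = (if length w \<le> length r then of_word (drop (length w) r)
     else inverse (of_word (take (length w - length r) w)))"

lemma exponent_sum_gap_of: "exponent_sum (gap_of w r) = int (length r) - int (length w)"
  by (simp add: gap_of_def exponent_sum_of_word exponent_sum_inverse)

lemma enumerate_range_eq:
  fixes g :: "nat \<Rightarrow> nat"
  assumes "strict_mono g"
  shows "enumerate (range g) = g"
proof
  fix n
  show "enumerate (range g) n = g n"
  proof (induction n)
    case 0
    show ?case
      using assms by (auto simp: enumerate_0 strict_mono_less_eq intro!: Least_equality)
  next
    case (Suc n)
    have "infinite (range g)"
      using assms by (simp add: finite_image_iff strict_mono_imp_inj_on)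
    then have "enumerate (range g) (Suc n) = (LEAST s. s \<in> range g \<and> g n < s)"
      by (simp add: enumerate_Suc'' Suc)
    also have "\<dots> = g (Suc n)"
      using assms
      by (auto simp: strict_mono_less strict_mono_less_eq Suc_le_eq intro!: Least_equality)
    finally show ?case .
  qed
qed

lemma gap_eq_gap_of:
  assumes "strict_mono g" "range g = occurrences w"
    and "block (g p) (g (Suc p) - g p) = r"
  shows "gap w (Suc p) = gap_of w r"
proof -
  have occ: "occ w (Suc q) = g q" for q
    using enumerate_range_eq[OF assms(1)] by (simp add: occ_def assms(2))
  have len: "length r = g (Suc p) - g p" using assms(3) by auto
  have less: "g p < g (Suc p)" using assms(1) by (simp add: strict_mono_Suc_iff)
  have "g (Suc p) \<in> occurrences w" using assms(2) by blast
  then have w: "block (g (Suc p)) (length w) = w" by (simp add: occurrences_iff_block)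
  show ?thesis
  proof (cases "length w \<le> length r")
    case True
    then have "drop (length w) r = block (g p + length w) (g (Suc p) - (g p + length w))"
      using assms(3) len by (auto simp: drop_block)
    moreover have "of_word [] = (1 :: letter free_group)" by transfer simp
    ultimately show ?thesis
      using True len less by (auto simp: gap_def occ gap_of_def Let_def)
  next
    case False
    then have "take (length w - length r) w = block (g (Suc p)) (g p + length w - g (Suc p))"
      using take_block[of "length w - length r" "length w" "g (Suc p)"] w len less
      by (simp add: add.commute)
    then show ?thesis
      using False len less by (auto simp: gap_def occ gap_of_def Let_def)
  qed
qed

theorem theorem2p2:
  fixes w :: "letter list"
  assumes "is_factor w" and "w \<notin> {[], [A, B], [B, A], [A, B, A]}"
  shows "(gap w 1 \<noteq> gap w 2 \<and> {gap w p | p. p \<ge> 1} = {gap w 1, gap w 2}) \<and>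
    (\<forall>p\<ge>1. (fib_seq (p - 1) = A \<longrightarrow> gap w p = gap w 1) \<and>
           (fib_seq (p - 1) = B \<longrightarrow> gap w p = gap w 2))"
proof -
  have "occurrences w \<noteq> {}"
    using assms(1) by (auto simp: is_factor_def occurrences_iff_block)
  then obtain R g where "dominates (R A) (R B)"
    and g: "strict_mono g" "range g = occurrences w"
      "\<And>p. block (g p) (g (Suc p) - g p) = R (fib_seq p)"
    using return_words_exist assms(2) unfolding return_words_def by blast
  have gap: "gap w p = gap_of w (R (fib_seq (p - 1)))" if "p \<ge> 1" for p
    using gap_eq_gap_of[OF g(1,2) g(3)[of "p - 1"]] that by simp
  have x1: "fib_seq 0 = A" and x2: "fib_seq 1 = B"
    using fib_seq_cut[of 0] fib_seq_Suc_cut[of 0] by simp_all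
  have gap1: "gap w 1 = gap_of w (R A)" and gap2: "gap w 2 = gap_of w (R B)"
    using gap[of 1] gap[of 2] x1 x2 by simp_all
  have "exponent_sum (gap w 1) \<noteq> exponent_sum (gap w 2)"
    using \<open>dominates (R A) (R B)\<close> 
    unfolding gap1 gap2 by (simp add: exponent_sum_gap_of dominates_def)
  then have "gap w 1 \<noteq> gap w 2" by metis
  moreover have letters: "\<forall>p\<ge>1. (fib_seq (p - 1) = A \<longrightarrow> gap w p = gap w 1) \<and>
           (fib_seq (p - 1) = B \<longrightarrow> gap w p = gap w 2)"
    unfolding gap1 gap2 by (auto simp: gap)
  moreover have "{gap w p | p. p \<ge> 1} = {gap w 1, gap w 2}"
  proof (intro equalityI subsetI)
    fix y assume "y \<in> {gap w p | p. p \<ge> 1}"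
    then obtain p where "y = gap w p" "p \<ge> 1" by blast
    with letters show "y \<in> {gap w 1, gap w 2}" by (cases "fib_seq (p - 1)") auto
  next
    fix y assume "y \<in> {gap w 1, gap w 2}"
    then show "y \<in> {gap w p | p. p \<ge> 1}" by fastforce
  qed
  ultimately show ?thesis by blast
qed

end
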